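(* Let $\mathcal{G}=(\mathcal{N},\mathcal{E})$ be a directed graph with node set $\mathcal{N}=\{1,\dots,n\}$, with matrix $P$ and dangling-node vector $\mathbf{d}$ as defined in the context, let $\alpha\in(0,1)$ be a fixed damping factor and $\mathbf{u}\in\mathbb{R}^n$ a fixed dangling node distribution ($\mathbf{u}>0$, $\mathbf{u}^T\mathbf{e}=1$). Let $X=(x_{pq})=(1-\alpha)\bigl(I_n-\alpha(P+\mathbf{d}\mathbf{u}^T)\bigr)^{-1}$. Then two nodes $i,j\in\mathcal{N}$, $i\neq j$, are effective competitors if and only if there exist $k,\ell\in\{1,\dots,n\}$ such that $$x_{ki}>x_{kj}\quad\text{and}\quad x_{\ell i}<x_{\ell j}.$$
   Context: The adjacency matrix $A=(a_{ij})$ of $\mathcal{G}$ has $a_{ij}=1$ if $(i,j)\in\mathcal{E}$ and $0$ otherwise; $k_{out}(i)=\sum_k a_{ik}$. A node $i$ is dangling if $k_{out}(i)=0$. The matrix $P=(p_{ij})$ has $p_{ij}=0$ for all $j$ if $i$ is dangling, and $p_{ij}=a_{ij}/k_{out}(i)$ otherwise. $\mathbf{d}\in\mathbb{R}^n$ has $d_i=1$ if $i$ is dangling and $d_i=0$ otherwise. $\mathbf{e}_1,\dots,\mathbf{e}_n$ are the standard basis column vectors and $\mathbf{e}=(1,\dots,1)^T$; $\mathbf{v}>0$ means all components are positive. A personalization vector is $\mathbf{v}\in\mathbb{R}^n$ with $\mathbf{v}>0$, $\mathbf{v}^T\mathbf{e}=1$. The Google matrix is $G=\alpha(P+\mathbf{d}\mathbf{u}^T)+(1-\alpha)\mathbf{e}\mathbf{v}^T$,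 and the personalized PageRank vector $\pi(\mathbf{v})$ is the unique vector with $\pi(\mathbf{v})>0$, $\pi(\mathbf{v})^T\mathbf{e}=1$, $\pi(\mathbf{v})^TG=\pi(\mathbf{v})^T$; equivalently $\pi(\mathbf{v})^T=\mathbf{v}^TX$. Two distinct nodes $i,j$ are effective competitors if there exist personalization vectors $\mathbf{v},\mathbf{w}$ with $\pi(\mathbf{v})^T\mathbf{e}_i>\pi(\mathbf{v})^T\mathbf{e}_j$ and $\pi(\mathbf{w})^T\mathbf{e}_i<\pi(\mathbf{w})^T\mathbf{e}_j$. *)

theory Defs
  imports "HOL-Analysis.Analysis"
begin

text \<open>The nodes are the elements of a finite type \<open>'n\<close>, so \<open>n = CARD('n)\<close>, and a directed graph
  is its edge set. Loops are allowed, as are graphs without edges.\<close>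

definition adjacency :: "('n \<times> 'n) set \<Rightarrow> real^'n^'n" where
  "adjacency E = (\<chi> i j. if (i, j) \<in> E then 1 else 0)"

definition out_deg :: "('n::finite \<times> 'n) set \<Rightarrow> 'n \<Rightarrow> real" where
  "out_deg E i = (\<Sum>k\<in>UNIV. adjacency E $ i $ k)"

definition dangling :: "('n::finite \<times> 'n) set \<Rightarrow> 'n \<Rightarrow> bool" where
  "dangling E i \<longleftrightarrow> out_deg E i = 0"

definition link_matrix :: "('n::finite \<times> 'n) set \<Rightarrow> real^'n^'n" where
  "link_matrix E = (\<chi> i j. if dangling E i then 0 else adjacency E $ i $ j / out_deg E i)"

definition dangling_vec :: "('n::finite \<times> 'n) set \<Rightarrow> real^'n" where
  "dangling_vec E = (\<chi> i. if dangling E i then 1 else 0)"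

definition outer_prod :: "real^'n \<Rightarrow> real^'m \<Rightarrow> real^'m^'n" where
  "outer_prod x y = (\<chi> i j. x $ i * y $ j)"

text \<open>Positivity is spelled out componentwise because the library's \<open>0 < v\<close> on \<open>real^'n\<close> only
  says that \<open>v\<close> is componentwise nonnegative and nonzero.\<close>

definition positive_vec :: "real^'n \<Rightarrow> bool" where
  "positive_vec v \<longleftrightarrow> (\<forall>i. v $ i > 0)"

text \<open>Both personalization vectors and dangling node distributions are vectors of this kind;
  \<open>1 :: real^'n\<close> is the all-ones vector.\<close>

definition positive_distribution :: "real^'n \<Rightarrow> bool" where
  "positive_distribution v \<longleftrightarrow> positive_vec v \<and> v \<bullet> 1 = 1"

definition google_matrix ::
  "('n::finite \<times> 'n) set \<Rightarrow> real \<Rightarrow> real^'n \<Rightarrow> real^'n \<Rightarrow> real^'n^'n" where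
  "google_matrix E \<alpha> u v =
     \<alpha> *\<^sub>R (link_matrix E + outer_prod (dangling_vec E) u) + (1 - \<alpha>) *\<^sub>R outer_prod 1 v"

definition pagerank :: "('n::finite \<times> 'n) set \<Rightarrow> real \<Rightarrow> real^'n \<Rightarrow> real^'n \<Rightarrow> real^'n" where
  "pagerank E \<alpha> u v = (THE p. positive_vec p \<and> p \<bullet> 1 = 1 \<and> p v* google_matrix E \<alpha> u v = p)"

definition effective_competitors ::
  "('n::finite \<times> 'n) set \<Rightarrow> real \<Rightarrow> real^'n \<Rightarrow> 'n \<Rightarrow> 'n \<Rightarrow> bool" where
  "effective_competitors E \<alpha> u i j \<longleftrightarrow> i \<noteq> j \<and>
     (\<exists>v w. positive_distribution v \<and> positive_distribution w \<and>
        pagerank E \<alpha> u v $ i > pagerank E \<alpha> u v $ j \<and>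
        pagerank E \<alpha> u w $ i < pagerank E \<alpha> u w $ j)"

definition pagerank_matrix :: "('n::finite \<times> 'n) set \<Rightarrow> real \<Rightarrow> real^'n \<Rightarrow> real^'n^'n" where
  "pagerank_matrix E \<alpha> u = (1 - \<alpha>) *\<^sub>R
     matrix_inv (mat 1 - \<alpha> *\<^sub>R (link_matrix E + outer_prod (dangling_vec E) u))"

end

theory Submission
  imports Defs
begin

text \<open>With \<open>S = P + d u\<^sup>T\<close> row-stochastic and \<open>\<alpha> < 1\<close>, the matrix \<open>I - \<alpha> S\<close> obeys a minimum
  principle, so it is invertible and \<open>X\<close> is a row-stochastic matrix with positive diagonal. Hence
  \<open>\<pi>(v) = v\<^sup>T X\<close>, and \<open>\<pi>(v)\<^sub>i - \<pi>(v)\<^sub>j\<close> is the average with weights \<open>v\<close> of the entries of the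
  difference \<open>c\<close> of columns \<open>i\<close> and \<open>j\<close> of \<open>X\<close>. Some positive average of \<open>c\<close> is positive iff some
  entry of \<open>c\<close> is: concentrate the weight on that entry.\<close>

definition row_stochastic :: "real^'n^'n \<Rightarrow> bool" where
  "row_stochastic S \<longleftrightarrow> (\<forall>i j. 0 \<le> S $ i $ j) \<and> S *v 1 = 1"

lemma row_stochastic_sum:
  assumes "row_stochastic S"
  shows "(\<Sum>j\<in>UNIV. S $ i $ j) = 1"
  using assms by (auto simp: row_stochastic_def vec_eq_iff matrix_vector_mult_def)

lemma inner_one: "v \<bullet> 1 = (\<Sum>i\<in>UNIV. v $ i)" for v :: "real^'n"
  by (simp add: inner_vec_def)

lemma vector_matrix_mult_outer_prod: "q v* outer_prod x y = (q \<bullet> x) *\<^sub>R y"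
  by (simp add: vec_eq_iff vector_matrix_mult_def outer_prod_def inner_vec_def
      sum_distrib_right mult.assoc)

lemma out_deg_nonneg: "0 \<le> out_deg E i"
  by (auto simp: out_deg_def adjacency_def intro: sum_nonneg)

text \<open>A dangling row of \<open>link_matrix E\<close> is zero and receives \<open>u\<close>,
  whose mass is 1; any other row is divided by its own nonzero sum \<open>out_deg E i\<close> and
  receives nothing.\<close>

lemma row_stochastic_link_matrix:
  assumes "positive_distribution u"
  shows "row_stochastic (link_matrix E + outer_prod (dangling_vec E) u)"
  unfolding row_stochastic_def
proof (intro conjI allI)
  fix i j
  have "0 \<le> adjacency E $ i $ j" "0 \<le> u $ j"
    using assms by (auto simp: adjacency_def positive_distribution_def positive_vec_def less_imp_le)
  then show "0 \<le> (link_matrix E + outer_prod (dangling_vec E) u) $ i $ j"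
    by (simp add: link_matrix_def outer_prod_def dangling_vec_def out_deg_nonneg)
next
  have "(\<Sum>j\<in>UNIV. (link_matrix E + outer_prod (dangling_vec E) u) $ i $ j) = 1" for i
  proof (cases "dangling E i")
    case True
    then show ?thesis
      using assms
      by (simp add: link_matrix_def outer_prod_def dangling_vec_def positive_distribution_def inner_one)
  next
    case False
    then have "(\<Sum>j\<in>UNIV. (link_matrix E + outer_prod (dangling_vec E) u) $ i $ j)
        = (\<Sum>j\<in>UNIV. adjacency E $ i $ j) / out_deg E i"
      by (simp add: link_matrix_def outer_prod_def dangling_vec_def sum_divide_distrib)
    also have "\<dots> = 1"
      using False by (simp add: out_deg_def[symmetric] dangling_def)
    finally show ?thesis .
  qed
  then show "(link_matrix E + outer_prod (dangling_vec E) u) *v 1 = 1"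
    by (simp add: vec_eq_iff matrix_vector_mult_def)
qed

lemma resolvent_mult_component:
  "((mat 1 - \<alpha> *\<^sub>R S) *v x) $ i = x $ i - \<alpha> * (\<Sum>j\<in>UNIV. S $ i $ j * x $ j)"
  for S :: "real^'n^'n"
  by (simp add: matrix_vector_mult_diff_rdistrib flip: scaleR_matrix_vector_assoc)
     (simp add: matrix_vector_mult_def)

text \<open>At an index \<open>m\<close> where \<open>x\<close> is least, row \<open>m\<close> of
  \<open>S\<close> averages entries that are all at least \<open>x $ m\<close>. The hypothesis at
  \<open>m\<close> then gives 0 \<le> (1 - \<alpha>) * \<open>x $ m\<close>, so even the least entry
  is nonnegative.\<close>

lemma minimum_principle:
  fixes S :: "real^'n^'n"
  assumes S: "row_stochastic S" and "0 \<le> \<alpha>" "\<alpha> < 1"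
    and b: "\<And>i. 0 \<le> ((mat 1 - \<alpha> *\<^sub>R S) *v x) $ i"
  shows "0 \<le> x $ i"
proof -
  have "Min (range (($) x)) \<in> range (($) x)"
    by (intro Min_in) auto
  then obtain m where m: "Min (range (($) x)) = x $ m"
    by (elim rangeE)
  have min: "x $ m \<le> x $ k" for k
    using Min_le[of "range (($) x)" "x $ k"] by (simp add: m)
  have "x $ m = (\<Sum>j\<in>UNIV. S $ m $ j * x $ m)"
    by (simp add: row_stochastic_sum[OF S] flip: sum_distrib_right)
  also have "\<dots> \<le> (\<Sum>j\<in>UNIV. S $ m $ j * x $ j)"
    using S by (intro sum_mono mult_left_mono min) (simp add: row_stochastic_def)
  finally have "\<alpha> * x $ m \<le> \<alpha> * (\<Sum>j\<in>UNIV. S $ m $ j * x $ j)"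
    using \<open>0 \<le> \<alpha>\<close> by (rule mult_left_mono)
  with b[of m] have "0 \<le> (1 - \<alpha>) * x $ m"
    unfolding resolvent_mult_component left_diff_distrib by linarith
  with \<open>\<alpha> < 1\<close> have "0 \<le> x $ m"
    by (simp add: zero_le_mult_iff)
  then show ?thesis
    using min by (rule order_trans)
qed

text \<open>The difference of the two sides is entry \<open>i\<close> of \<alpha> times
  \<open>S *v x\<close>, which is nonnegative because \<open>x\<close> is. This sharper bound is
  what makes the diagonal of X strictly positive.\<close>

lemma minimum_principle_ge:
  fixes S :: "real^'n^'n"
  assumes S: "row_stochastic S" and \<alpha>: "0 \<le> \<alpha>" "\<alpha> < 1"
    and b: "\<And>i. 0 \<le> ((mat 1 - \<alpha> *\<^sub>R S) *v x) $ i"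
  shows "((mat 1 - \<alpha> *\<^sub>R S) *v x) $ i \<le> x $ i"
proof -
  have "0 \<le> \<alpha> * (\<Sum>j\<in>UNIV. S $ i $ j * x $ j)"
    using S \<alpha> minimum_principle[OF S \<alpha> b]
    by (intro mult_nonneg_nonneg sum_nonneg) (auto simp: row_stochastic_def)
  then show ?thesis
    by (simp add: resolvent_mult_component)
qed

text \<open>The minimum principle applies to a kernel vector and to its negative, so the kernel is
  trivial.\<close>

lemma resolvent_invertible:
  fixes S :: "real^'n^'n"
  assumes S: "row_stochastic S" and \<alpha>: "0 \<le> \<alpha>" "\<alpha> < 1"
  shows "invertible (mat 1 - \<alpha> *\<^sub>R S)"
proof -
  have "x = 0" if "(mat 1 - \<alpha> *\<^sub>R S) *v x = 0" for x
  proof -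
    have "0 \<le> x $ i" for i
      by (rule minimum_principle[OF S \<alpha>]) (simp add: that)
    moreover have "0 \<le> (- x) $ i" for i
      by (rule minimum_principle[OF S \<alpha>]) (simp add: that linear_neg[OF matrix_vector_mul_linear])
    ultimately show ?thesis
      by (simp add: vec_eq_iff order_antisym)
  qed
  then show ?thesis
    using invertible_left_inverse matrix_left_invertible_ker by blast
qed

text \<open>Existence and uniqueness of the PageRank vector are settled here as well, as the
  definite description requires. Among vectors of total mass 1, being fixed by the Google matrix
  amounts to \<open>q v* M = (1 - \<alpha>) *\<^sub>R v\<close>, which X solves.\<close>

lemma pagerank_eq:
  fixes E :: "('n::finite \<times> 'n) set" and u v :: "real^'n"
  assumes \<alpha>: "0 < \<alpha>" "\<alpha> < 1" and u: "positive_distribution u" and v: "positive_distribution v"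
  shows "pagerank E \<alpha> u v = v v* pagerank_matrix E \<alpha> u"
proof -
  define S where "S = link_matrix E + outer_prod (dangling_vec E) u"
  define M where "M = mat 1 - \<alpha> *\<^sub>R S"
  define X where "X = pagerank_matrix E \<alpha> u"
  note S = row_stochastic_link_matrix[OF u, of E, folded S_def]
  have \<alpha>': "0 \<le> \<alpha>" "1 - \<alpha> \<noteq> 0"
    using \<alpha> by auto
  have X: "X = (1 - \<alpha>) *\<^sub>R matrix_inv M"
    by (simp add: X_def pagerank_matrix_def M_def S_def)
  have inv: "invertible M"
    unfolding M_def using resolvent_invertible[OF S \<alpha>'(1) \<alpha>(2)] .
  \<comment> \<open>\<open>matrix_inv\<close> is a choice of a two-sided inverse, so invertibility
    yields both products at once.\<close>
  have XM: "X ** M = (1 - \<alpha>) *\<^sub>R mat 1" and MX: "M ** X = (1 - \<alpha>) *\<^sub>R mat 1"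
    using someI_ex[OF inv[unfolded invertible_def], folded matrix_inv_def]
    by (simp_all add: X matrix_scalar_ac flip: scalar_matrix_assoc)
  have X_one: "X *v 1 = 1"
  proof -
    have "M *v 1 = (1 - \<alpha>) *\<^sub>R 1"
      by (simp add: vec_eq_iff M_def resolvent_mult_component row_stochastic_sum[OF S])
    then have "(1 - \<alpha>) *\<^sub>R (X *v 1) = X *v (M *v 1)"
      by (simp add: matrix_vector_mult_scaleR)
    also have "\<dots> = (1 - \<alpha>) *\<^sub>R 1"
      by (simp add: matrix_vector_mul_assoc XM flip: scaleR_matrix_vector_assoc)
    finally show ?thesis
      using \<alpha>'(2) by simp
  qed
  have MX_col: "(M *v (X *v axis k 1)) $ l = (if l = k then 1 - \<alpha> else 0)" for k l
    by (simp add: matrix_vector_mul_assoc MX axis_def flip: scaleR_matrix_vector_assoc)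
  \<comment> \<open>Column \<open>k\<close> of X solves M x = (1 - \<alpha>) e_k, whose right-hand
    side is nonnegative and hence bounds the column from below.\<close>
  have X_entry: "(if l = k then 1 - \<alpha> else 0) \<le> X $ l $ k" for k l
    using minimum_principle_ge[OF S \<alpha>'(1) \<alpha>(2), of "X *v axis k 1" l] \<alpha> MX_col[of k]
    by (simp add: M_def[symmetric] matrix_vector_mult_basis column_def)
  \<comment> \<open>Normalization of \<open>q\<close> turns the rank-one teleportation term into the
    constant vector \<open>(1 - \<alpha>) *\<^sub>R v\<close>.\<close>
  have G: "q v* google_matrix E \<alpha> u v = q - q v* M + (1 - \<alpha>) *\<^sub>R v" if "q \<bullet> 1 = 1" for q
  proof -
    have "q v* google_matrix E \<alpha> u v = \<alpha> *\<^sub>R (q v* S) + (1 - \<alpha>) *\<^sub>R ((q \<bullet> 1) *\<^sub>R v)"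
      by (simp add: google_matrix_def S_def[symmetric] vector_matrix_mult_add_rdistrib
          vector_scaleR_matrix_ac vector_matrix_mult_outer_prod)
    moreover have "q v* M = q - \<alpha> *\<^sub>R (q v* S)"
      by (simp add: M_def vector_matrix_mult_diff_rdistrib vector_scaleR_matrix_ac)
    ultimately show ?thesis
      using that by simp
  qed
  have v_sum: "v \<bullet> 1 = 1" and v_pos: "0 < v $ k" for k
    using v by (auto simp: positive_distribution_def positive_vec_def)
  have "pagerank E \<alpha> u v = v v* X"
    unfolding pagerank_def
  proof (rule the_equality, intro conjI)
    have "0 < (v v* X) $ k" for k
    proof -
      have "0 \<le> X $ l $ k" for l
        using X_entry[of l k] \<alpha> by (auto split: if_splits)
      moreover have "0 < X $ k $ k"
        using X_entry[of k k] \<alpha> by simp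
      ultimately show ?thesis
        unfolding vector_matrix_mult_def
        by (auto simp: v_pos less_imp_le intro!: sum_pos2[of _ k])
    qed
    then show "positive_vec (v v* X)"
      by (simp add: positive_vec_def)
    show sum: "(v v* X) \<bullet> 1 = 1"
      by (simp add: dot_lmul_matrix X_one v_sum)
    have "v v* X v* M = (1 - \<alpha>) *\<^sub>R v"
      by (simp add: vector_matrix_mul_assoc XM vector_scaleR_matrix_ac)
    then show "v v* X v* google_matrix E \<alpha> u v = v v* X"
      unfolding G[OF sum] by simp
  next
    \<comment> \<open>Uniqueness: the fixed-point equation determines \<open>q v* M\<close>, and
      multiplying by X on the right recovers \<open>q\<close> up to the nonzero factor 1 -
      \<alpha>.\<close>
    fix q
    assume q: "positive_vec q \<and> q \<bullet> 1 = 1 \<and> q v* google_matrix E \<alpha> u v = q"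
    then have "q v* M = (1 - \<alpha>) *\<^sub>R v"
      using G[of q] by (simp add: algebra_simps)
    then have "(1 - \<alpha>) *\<^sub>R (v v* X) = q v* M v* X"
      by (simp add: scaleR_vector_matrix_assoc)
    also have "\<dots> = (1 - \<alpha>) *\<^sub>R q"
      by (simp add: vector_matrix_mul_assoc MX vector_scaleR_matrix_ac)
    finally show "q = v v* X"
      using \<alpha>'(2) by simp
  qed
  then show ?thesis
    by (simp add: X_def)
qed

lemma ex_positive_distribution_inner_pos_iff:
  fixes c :: "real^'n"
  shows "(\<exists>v. positive_distribution v \<and> 0 < v \<bullet> c) \<longleftrightarrow> (\<exists>k. 0 < c $ k)"
proof
  assume "\<exists>v. positive_distribution v \<and> 0 < v \<bullet> c"
  then obtain v where v: "\<And>k. 0 \<le> v $ k" "0 < v \<bullet> c"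
    by (meson less_imp_le positive_distribution_def positive_vec_def)
  show "\<exists>k. 0 < c $ k"
  proof (rule ccontr)
    assume "\<nexists>k. 0 < c $ k"
    then have "v \<bullet> c \<le> 0"
      using v(1) by (auto simp: inner_vec_def not_less intro!: sum_nonpos mult_nonneg_nonpos)
    with v(2) show False
      by simp
  qed
next
  assume "\<exists>k. 0 < c $ k"
  then obtain k where k: "0 < c $ k" ..
  \<comment> \<open>The extra weight \<open>t\<close> at \<open>k\<close> contributes
    \<open>t * c $ k\<close>, which exceeds the absolute value of \<open>1 \<bullet> c\<close> by 1.
    The all-ones part of \<open>w\<close> keeps every weight positive, and \<open>N\<close> is the
    total mass to divide by.\<close>
  define t where "t = (\<bar>1 \<bullet> c\<bar> + 1) / c $ k"
  define w :: "real^'n" where "w = 1 + t *\<^sub>R axis k 1"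
  define N where "N = real CARD('n) + t"
  have "0 < t"
    using k by (auto simp: t_def intro!: divide_pos_pos add_nonneg_pos)
  then have "0 < N"
    by (simp add: N_def add_nonneg_pos)
  have "(1 :: real^'n) \<bullet> 1 = CARD('n)"
    by (simp add: inner_one)
  then have "w \<bullet> 1 = N"
    by (simp add: w_def N_def inner_add_left inner_axis')
  have "w \<bullet> c = 1 \<bullet> c + t * c $ k"
    by (simp add: w_def inner_add_left inner_axis')
  also have "\<dots> = 1 \<bullet> c + \<bar>1 \<bullet> c\<bar> + 1"
    using k by (simp add: t_def)
  finally have "0 < w \<bullet> c"
    by linarith
  have "0 < w $ i" for i
    using \<open>0 < t\<close> by (simp add: w_def axis_def)
  with \<open>0 < N\<close> \<open>w \<bullet> 1 = N\<close> have "positive_distribution ((1 / N) *\<^sub>R w)"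
    by (simp add: positive_distribution_def positive_vec_def)
  moreover have "0 < ((1 / N) *\<^sub>R w) \<bullet> c"
    using \<open>0 < N\<close> \<open>0 < w \<bullet> c\<close> by simp
  ultimately show "\<exists>v. positive_distribution v \<and> 0 < v \<bullet> c"
    by blast
qed

text \<open>The two vectors in \<open>effective_competitors\<close> are chosen independently, so
  each inequality can be treated alone; the theorem uses this equivalence for both orders of
  \<open>i\<close> and \<open>j\<close>.\<close>

lemma ex_pagerank_less_iff:
  assumes "0 < \<alpha>" "\<alpha> < 1" "positive_distribution u"
  shows "(\<exists>v. positive_distribution v \<and> pagerank E \<alpha> u v $ i < pagerank E \<alpha> u v $ j) \<longleftrightarrow>
    (\<exists>k. pagerank_matrix E \<alpha> u $ k $ i < pagerank_matrix E \<alpha> u $ k $ j)"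
proof -
  define c where "c = column j (pagerank_matrix E \<alpha> u) - column i (pagerank_matrix E \<alpha> u)"
  have "pagerank E \<alpha> u v $ i < pagerank E \<alpha> u v $ j \<longleftrightarrow> 0 < v \<bullet> c"
    if "positive_distribution v" for v
    by (simp add: pagerank_eq[OF assms that] c_def inner_diff_right)
       (simp add: inner_vec_def column_def vector_matrix_mult_def mult.commute)
  moreover have "c $ k = pagerank_matrix E \<alpha> u $ k $ j - pagerank_matrix E \<alpha> u $ k $ i" for k
    by (simp add: c_def column_def)
  ultimately show ?thesis
    using ex_positive_distribution_inner_pos_iff[of c] by auto
qed

theorem theorem2:
  fixes E :: "('n::finite \<times> 'n) set" and \<alpha> :: real and u :: "real^'n" and i j :: 'n
  assumes "0 < \<alpha>" and "\<alpha> < 1"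
    and "positive_distribution u"
    and "i \<noteq> j"
  shows "effective_competitors E \<alpha> u i j \<longleftrightarrow>
    (\<exists>k l. pagerank_matrix E \<alpha> u $ k $ i > pagerank_matrix E \<alpha> u $ k $ j \<and>
           pagerank_matrix E \<alpha> u $ l $ i < pagerank_matrix E \<alpha> u $ l $ j)"
  using ex_pagerank_less_iff[OF assms(1-3), of E i j] ex_pagerank_less_iff[OF assms(1-3), of E j i]
    \<open>i \<noteq> j\<close>
  unfolding effective_competitors_def by blast

end
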